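(* Let $X$ be a Polish metric space. There exist an isometric copy $X'\subset\mathbb U$ of $X$ and an isometry $\varphi$ of $\mathbb U$ (onto $\mathbb U$) such that $\mathrm{Fix}(\varphi)=X'$.
   Context: A Polish metric space is a complete separable metric space. $\mathbb U$ denotes the Urysohn space: the unique (up to isometry) nonempty complete separable metric space that is finitely injective, i.e. for any finite metric spaces $K\subseteq L$ and any isometric embedding $\varphi\colon K\to\mathbb U$ there is an isometric embedding $\tilde\varphi\colon L\to\mathbb U$ extending $\varphi$. $\mathrm{Fix}(\varphi)$ is the set of fixed points of $\varphi$. *)

theory Defs
  imports "HOL-Analysis.Abstract_Metric_Spaces"
begin

text \<open>
  Metric spaces are elements of the library type \<open>'a metric\<close>, whose carrier \<open>mspace m\<close> may be a
  proper (possibly empty) subset of the type. Maps between such spaces are total functions of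
  which only the values on the carrier matter.
\<close>

definition separable_metric :: "'a metric \<Rightarrow> bool" where
  "separable_metric m \<longleftrightarrow>
     (\<exists>C. countable C \<and> C \<subseteq> mspace m \<and> mtopology_of m closure_of C = mspace m)"

definition Polish_metric :: "'a metric \<Rightarrow> bool" where
  "Polish_metric m \<longleftrightarrow> mcomplete_of m \<and> separable_metric m"

definition isometric_embedding :: "'a metric \<Rightarrow> 'b metric \<Rightarrow> ('a \<Rightarrow> 'b) \<Rightarrow> bool" where
  "isometric_embedding m m' f \<longleftrightarrow>
     f \<in> mspace m \<rightarrow> mspace m' \<and>
     (\<forall>x\<in>mspace m. \<forall>y\<in>mspace m. mdist m' (f x) (f y) = mdist m x y)"

definition isometry_onto :: "'a metric \<Rightarrow> 'b metric \<Rightarrow> ('a \<Rightarrow> 'b) \<Rightarrow> bool" where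
  "isometry_onto m m' f \<longleftrightarrow> isometric_embedding m m' f \<and> f ` mspace m = mspace m'"

definition isometric_copy :: "'a metric \<Rightarrow> 'b metric \<Rightarrow> 'b set \<Rightarrow> bool" where
  "isometric_copy X m X' \<longleftrightarrow>
     X' \<subseteq> mspace m \<and> (\<exists>f. isometry_onto X (submetric m X') f)"

text \<open>
  A definition cannot quantify over types, so the finite metric spaces \<open>K \<subseteq> L\<close> are taken with
  points in \<open>nat\<close>. No generality is lost: every finite metric space is isometric to one of these.
\<close>

definition finitely_injective :: "'a metric \<Rightarrow> bool" where
  "finitely_injective m \<longleftrightarrow>
     (\<forall>(L :: nat metric) K \<phi>.
        finite (mspace L) \<and> K \<subseteq> mspace L \<and> isometric_embedding (submetric L K) m \<phi> \<longrightarrow>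
        (\<exists>\<psi>. isometric_embedding L m \<psi> \<and> (\<forall>x\<in>K. \<psi> x = \<phi> x)))"

text \<open>
  The Urysohn space is determined only up to isometry; the predicate singles out its isometry
  class.
\<close>

definition Urysohn_metric :: "'a metric \<Rightarrow> bool" where
  "Urysohn_metric m \<longleftrightarrow> mspace m \<noteq> {} \<and> Polish_metric m \<and> finitely_injective m"

definition Fix :: "'a metric \<Rightarrow> ('a \<Rightarrow> 'a) \<Rightarrow> 'a set" where
  "Fix m \<phi> = {x \<in> mspace m. \<phi> x = x}"

end

theory Submission
  imports Defs
begin

text \<open>
  A countable set with a free shift action is given an invariant pseudometric stage by stage, while a
  back-and-forth argument maps it isometrically onto a dense subset of \<open>U\<close>. The starting stage
  is a dense sequence in \<open>X\<close>, fixed by the shift. To hit a given point \<open>u\<close> of \<open>U\<close>, whose distances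
  to the finitely many points mapped so far are known, one adds a whole orbit with these distances
  at position \<open>0\<close>, amalgamated as freely as possible. A uniform lower bound for the displacement in
  terms of the distance to \<open>X\<close> cannot hold. What survives free amalgamation over finite sets, and
  also the passage to the completion, is that \<open>d p (shift m q)\<close> is eventually at least the length
  of the shortest path from \<open>p\<close> to \<open>q\<close> through \<open>X\<close>. For a fixed point \<open>p = q\<close> of the extended
  shift this length is twice the distance to \<open>X\<close>, hence the fixed points are exactly those of \<open>X\<close>.
\<close>

section \<open>Extending isometries from dense families to complete spaces\<close>

text \<open>A sequence of the \<open>a i\<close> converging to \<open>p\<close> is Cauchy, so the
  corresponding \<open>b i\<close> are Cauchy too, and their limit is the required point. Only the
  one point \<open>p\<close> has to be approximable, so the lemma serves both to extend an isometry
  and, with the two spaces exchanged, to pull a point back.\<close>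

lemma complete_limit_point:
  fixes a :: "'i \<Rightarrow> 'a" and b :: "'i \<Rightarrow> 'b"
  assumes complete: "mcomplete_of M'"
    and a: "\<And>i. a i \<in> mspace M" and b: "\<And>i. b i \<in> mspace M'"
    and dist: "\<And>i j. mdist M' (b i) (b j) = mdist M (a i) (a j)"
    and p: "p \<in> mspace M" and dense: "\<And>e. e > 0 \<Longrightarrow> \<exists>i. mdist M (a i) p < e"
  shows "\<exists>y\<in>mspace M'. \<forall>i. mdist M' y (b i) = mdist M p (a i)"
proof -
  interpret M': Metric_space "mspace M'" "mdist M'" by simp
  have "\<forall>n. \<exists>i. mdist M (a i) p < inverse (real (Suc n))"
    by (intro allI dense) simp
  then obtain s where s: "\<And>n. mdist M (a (s n)) p < inverse (real (Suc n))"
    by metis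
  have small: "\<exists>N. \<forall>n\<ge>N. mdist M (a (s n)) p < e" if "e > 0" for e
  proof -
    obtain N where N: "inverse (real (Suc N)) < e"
      using reals_Archimedean \<open>e > 0\<close> by blast
    have "mdist M (a (s n)) p < e" if "n \<ge> N" for n
    proof -
      have "inverse (real (Suc n)) \<le> inverse (real (Suc N))"
        using that by (simp add: le_imp_inverse_le)
      then show ?thesis using s[of n] N by linarith
    qed
    then show ?thesis by blast
  qed
  have "M'.MCauchy (b \<circ> s)"
    unfolding M'.MCauchy_def
  proof (intro conjI allI impI)
    show "range (b \<circ> s) \<subseteq> mspace M'" using b by auto
    fix e :: real assume "e > 0"
    then obtain N where N: "\<And>n. n \<ge> N \<Longrightarrow> mdist M (a (s n)) p < e / 2"
      using small[of "e/2"] by auto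
    have "mdist M' ((b \<circ> s) n) ((b \<circ> s) n') < e" if "N \<le> n" "N \<le> n'" for n n'
    proof -
      have "mdist M (a (s n)) (a (s n')) \<le> mdist M (a (s n)) p + mdist M (a (s n')) p"
        using mdist_triangle[OF a p a, of "s n" "s n'"] mdist_commute[of M p "a (s n')"] by simp
      then show ?thesis using N[OF that(1)] N[OF that(2)] dist by simp
    qed
    then show "\<exists>N. \<forall>n n'. N \<le> n \<longrightarrow> N \<le> n' \<longrightarrow> mdist M' ((b \<circ> s) n) ((b \<circ> s) n') < e" by blast
  qed
  then obtain y where y: "limitin M'.mtopology (b \<circ> s) y sequentially"
    using complete unfolding mcomplete_of_def M'.mcomplete_def by blast
  have yM: "y \<in> mspace M'" using y M'.limitin_mspace by blast
  have "mdist M' y (b i) = mdist M p (a i)" for i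
  proof -
    have "\<bar>mdist M' y (b i) - mdist M p (a i)\<bar> \<le> 0 + e" if "e > 0" for e
    proof -
      obtain N where N: "\<And>n. n \<ge> N \<Longrightarrow> mdist M (a (s n)) p < e / 2"
        using small[of "e/2"] \<open>e > 0\<close> by auto
      obtain N' where N': "\<And>n. n \<ge> N' \<Longrightarrow> mdist M' (b (s n)) y < e / 2"
        using y \<open>e > 0\<close> unfolding M'.limit_metric_sequentially
        by (metis comp_apply half_gt_zero)
      define n where "n = max N N'"
      have n: "mdist M (a (s n)) p < e / 2" "mdist M' (b (s n)) y < e / 2"
        using N N' unfolding n_def by auto
      have "mdist M' y (b i) \<le> mdist M' y (b (s n)) + mdist M' (b (s n)) (b i)"
        "mdist M' (b (s n)) (b i) \<le> mdist M' (b (s n)) y + mdist M' y (b i)"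
        "mdist M p (a i) \<le> mdist M p (a (s n)) + mdist M (a (s n)) (a i)"
        "mdist M (a (s n)) (a i) \<le> mdist M (a (s n)) p + mdist M p (a i)"
        by (intro mdist_triangle a b p yM)+
      then show ?thesis using n dist[of "s n" i] by (simp add: mdist_commute)
    qed
    then have "\<bar>mdist M' y (b i) - mdist M p (a i)\<bar> \<le> 0"
      by (rule field_le_epsilon)
    then show ?thesis by simp
  qed
  then show ?thesis using yM by blast
qed

text \<open>The point of \<open>M'\<close> with the right distances to all \<open>b i\<close> is
  taken as \<open>g p\<close>. Replacing \<open>p\<close> by a nearby \<open>a i\<close> shows that
  \<open>g\<close> preserves distances up to every \<open>e > 0\<close>.\<close>

lemma isometric_extension:
  fixes a :: "'i \<Rightarrow> 'a" and b :: "'i \<Rightarrow> 'b"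
  assumes complete: "mcomplete_of M'"
    and a: "\<And>i. a i \<in> mspace M" and b: "\<And>i. b i \<in> mspace M'"
    and dist: "\<And>i j. mdist M' (b i) (b j) = mdist M (a i) (a j)"
    and dense: "\<And>p e. p \<in> mspace M \<Longrightarrow> e > 0 \<Longrightarrow> \<exists>i. mdist M (a i) p < e"
  obtains g where "isometric_embedding M M' g" and "\<And>i. g (a i) = b i"
proof -
  have "\<forall>p\<in>mspace M. \<exists>y\<in>mspace M'. \<forall>i. mdist M' y (b i) = mdist M p (a i)"
    using complete_limit_point[of M' a M b, OF complete a b dist] dense by blast
  then obtain g where g: "\<And>p. p \<in> mspace M \<Longrightarrow> g p \<in> mspace M'"
    and gd: "\<And>p i. p \<in> mspace M \<Longrightarrow> mdist M' (g p) (b i) = mdist M p (a i)"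
    by metis
  have "mdist M' (g p) (g q) = mdist M p q" if p: "p \<in> mspace M" and q: "q \<in> mspace M" for p q
  proof -
    have "\<bar>mdist M' (g p) (g q) - mdist M p q\<bar> \<le> 0 + e" if "e > 0" for e
    proof -
      obtain i where i: "mdist M (a i) p < e / 2" using dense[OF p, of "e/2"] \<open>e > 0\<close> by auto
      have "mdist M' (g p) (g q) \<le> mdist M' (g p) (b i) + mdist M' (b i) (g q)"
        "mdist M' (b i) (g q) \<le> mdist M' (b i) (g p) + mdist M' (g p) (g q)"
        "mdist M p q \<le> mdist M p (a i) + mdist M (a i) q"
        "mdist M (a i) q \<le> mdist M (a i) p + mdist M p q"
        by (intro mdist_triangle a b p q g)+
      then show ?thesis using i gd[OF p, of i] gd[OF q, of i] by (simp add: mdist_commute)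
    qed
    then have "\<bar>mdist M' (g p) (g q) - mdist M p q\<bar> \<le> 0"
      by (rule field_le_epsilon)
    then show ?thesis by simp
  qed
  moreover have "g (a i) = b i" for i
    using gd[OF a, of i i] mdist_zero[OF a a, of i i] mdist_zero[OF g[OF a] b, of i i] by simp
  ultimately show thesis using that g unfolding isometric_embedding_def by blast
qed

text \<open>An isometric image of a complete space is closed: \<open>w\<close> is pulled back to a
  point \<open>y\<close> with the same distances, and \<open>g y\<close> is then arbitrarily close
  to \<open>w\<close>. This yields both the surjectivity of the extended shift and the inclusion of
  its fixed points in the copy of \<open>X\<close>.\<close>

lemma isometric_embedding_range:
  fixes a :: "'i \<Rightarrow> 'a"
  assumes complete: "mcomplete_of M" and g: "isometric_embedding M M' g"
    and a: "\<And>i. a i \<in> mspace M"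
    and w: "w \<in> mspace M'" and near: "\<And>e. e > 0 \<Longrightarrow> \<exists>i. mdist M' (g (a i)) w < e"
  shows "w \<in> g ` mspace M"
proof -
  have gM: "\<And>x. x \<in> mspace M \<Longrightarrow> g x \<in> mspace M'"
    and gd: "\<And>x y. x \<in> mspace M \<Longrightarrow> y \<in> mspace M \<Longrightarrow> mdist M' (g x) (g y) = mdist M x y"
    using g unfolding isometric_embedding_def by auto
  have "\<exists>y\<in>mspace M. \<forall>i. mdist M y (a i) = mdist M' w (g (a i))"
    by (rule complete_limit_point[OF complete _ a _ w near]) (simp_all add: gM gd a)
  then obtain y where y: "y \<in> mspace M" and yd: "\<And>i. mdist M y (a i) = mdist M' w (g (a i))"
    by blast
  have "mdist M' (g y) w \<le> 0 + e" if "e > 0" for e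
  proof -
    obtain i where i: "mdist M' (g (a i)) w < e / 2" using near[of "e/2"] \<open>e > 0\<close> by auto
    have "mdist M' (g y) w \<le> mdist M' (g y) (g (a i)) + mdist M' (g (a i)) w"
      by (intro mdist_triangle gM a y w)
    then show ?thesis using i yd[of i] gd[OF y a, of i] by (simp add: mdist_commute)
  qed
  then have "mdist M' (g y) w \<le> 0" by (rule field_le_epsilon)
  then have "mdist M' (g y) w = 0" using mdist_nonneg[of M' "g y" w] by linarith
  then have "g y = w" using mdist_zero[OF gM[OF y] w] by blast
  then show ?thesis using y by blast
qed

section \<open>Realising prescribed distances in the Urysohn space\<close>

text \<open>The conditions on \<open>f\<close> say that it is a Katetov function, that is, a
  possible distance function of one additional point. To apply finite injectivity, \<open>S\<close>
  is numbered by \<open>{..<card S}\<close> and the additional point is \<open>card S\<close>. If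
  \<open>f\<close> vanishes at some \<open>s\<close>, then \<open>s\<close> itself is the point;
  otherwise \<open>f\<close> is positive and the enlarged space is a true metric space.\<close>

lemma finitely_injective_one_point:
  fixes U :: "'u metric"
  assumes U: "Urysohn_metric U" and S: "finite S" "S \<subseteq> mspace U"
    and nonneg: "\<And>s. s \<in> S \<Longrightarrow> 0 \<le> f s"
    and lip: "\<And>s t. s \<in> S \<Longrightarrow> t \<in> S \<Longrightarrow> f s \<le> f t + mdist U s t"
    and tri: "\<And>s t. s \<in> S \<Longrightarrow> t \<in> S \<Longrightarrow> mdist U s t \<le> f s + f t"
  shows "\<exists>u\<in>mspace U. \<forall>s\<in>S. mdist U u s = f s"
proof (cases "\<exists>s\<in>S. f s = 0")
  case True
  then obtain s where s: "s \<in> S" "f s = 0" by blast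
  have "mdist U s t = f t" if "t \<in> S" for t
    using lip[OF s(1) that] lip[OF that s(1)] tri[OF s(1) that] s(2) by (simp add: mdist_commute)
  then show ?thesis using s S by blast
next
  case False
  then have pos: "\<And>s. s \<in> S \<Longrightarrow> f s > 0" using nonneg by (metis less_eq_real_def)
  obtain e where e: "bij_betw e {..<card S} S"
    using ex_bij_betw_nat_finite[OF S(1)] by (auto simp: lessThan_atLeast0)
  let ?n = "card S"
  have eS: "\<And>i. i < ?n \<Longrightarrow> e i \<in> S" using e by (auto simp: bij_betw_def)
  have einj: "\<And>i j. i < ?n \<Longrightarrow> j < ?n \<Longrightarrow> e i = e j \<Longrightarrow> i = j"
    using e by (auto simp: bij_betw_def inj_on_def)
  \<comment> \<open>The value \<open>0\<close> beyond \<open>card S\<close> is a filler: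
    nonnegativity and symmetry are demanded on the whole type, the other axioms only on the
    carrier.\<close>
  define D where "D i j = (if i = j \<or> i > ?n \<or> j > ?n then 0
     else if i = ?n then f (e j) else if j = ?n then f (e i) else mdist U (e i) (e j))" for i j
  have e_eq: "mdist U (e i) (e j) = 0 \<longleftrightarrow> i = j" if "i < ?n" "j < ?n" for i j
    using eS[OF that(1)] eS[OF that(2)] einj[OF that] S(2) mdist_zero[of "e i" U "e j"] by blast
  have ms: "Metric_space {..?n} D"
  proof
    show "0 \<le> D x y" for x y
      unfolding D_def using nonneg eS by auto
    show "D x y = D y x" for x y
      unfolding D_def by (auto simp: mdist_commute)
    show "(D x y = 0) = (x = y)" if "x \<in> {..?n}" "y \<in> {..?n}" for x y
    proof -
      have "x = ?n \<or> x < ?n" "y = ?n \<or> y < ?n" using that by auto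
      then show ?thesis
        unfolding D_def using pos[OF eS, of x] pos[OF eS, of y] e_eq[of x y] by auto
    qed
    show "D x z \<le> D x y + D y z" if "x \<in> {..?n}" "y \<in> {..?n}" "z \<in> {..?n}" for x y z
    proof -
      have *: "x = ?n \<or> x < ?n" "y = ?n \<or> y < ?n" "z = ?n \<or> z < ?n" using that by auto
      have lt: "mdist U (e x) (e z) \<le> mdist U (e x) (e y) + mdist U (e y) (e z)"
        if "x < ?n" "y < ?n" "z < ?n"
        using that by (intro mdist_triangle subsetD[OF S(2)] eS)
      have D_old: "D i j = mdist U (e i) (e j)" if "i < ?n" "j < ?n" for i j
        using that e_eq[of i j] by (auto simp: D_def)
      have D_new: "D ?n j = f (e j)" "D j ?n = f (e j)" if "j < ?n" for j
        using that by (auto simp: D_def)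
      have D_nn: "D ?n ?n = 0" by (simp add: D_def)
      have kat: "f (e i) \<le> f (e j) + mdist U (e i) (e j)" "f (e i) \<le> f (e j) + mdist U (e j) (e i)"
          "mdist U (e i) (e j) \<le> f (e i) + f (e j)" "0 \<le> f (e i)" if "i < ?n" "j < ?n" for i j
        using that lip[OF eS eS, of i j] tri[OF eS eS, of i j] nonneg[OF eS, of i]
        by (auto simp: mdist_commute)
      from * show ?thesis
        by (elim disjE) (use lt kat[of y y] kat[of x y] kat[of y z] kat[of z y] kat[of y x] kat[of x z] in
          \<open>simp_all add: D_old D_new D_nn\<close>)
    qed
  qed
  define L where "L = metric ({..?n}, D)"
  have L: "mspace L = {..?n}" "mdist L = D"
    using ms by (simp_all add: L_def Metric_space.mspace_metric Metric_space.mdist_metric)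
  have "isometric_embedding (submetric L {..<?n}) U e"
    unfolding isometric_embedding_def using S(2) eS e_eq
    by (auto simp: L D_def Pi_iff)
  then have "finite (mspace L) \<and> {..<?n} \<subseteq> mspace L \<and> isometric_embedding (submetric L {..<?n}) U e"
    by (auto simp: L)
  moreover have "finitely_injective U" using U by (simp add: Urysohn_metric_def)
  ultimately obtain \<psi> where \<psi>: "isometric_embedding L U \<psi>" "\<forall>x\<in>{..<?n}. \<psi> x = e x"
    unfolding finitely_injective_def by meson
  then have \<psi>U: "\<And>i. i \<le> ?n \<Longrightarrow> \<psi> i \<in> mspace U"
    and \<psi>d: "\<And>i j. i \<le> ?n \<Longrightarrow> j \<le> ?n \<Longrightarrow> mdist U (\<psi> i) (\<psi> j) = D i j"
    unfolding isometric_embedding_def L by blast+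
  have "mdist U (\<psi> ?n) s = f s" if s: "s \<in> S" for s
  proof -
    obtain i where i: "i < ?n" "s = e i" using bij_betw_imp_surj_on[OF e] s by blast
    have "D ?n i = f (e i)" using i(1) by (auto simp: D_def)
    moreover have "\<psi> i = e i" using \<psi>(2) i(1) by blast
    ultimately show ?thesis using \<psi>d[OF order_refl less_imp_le[OF i(1)]] i(2) by metis
  qed
  then show ?thesis using \<psi>U by blast
qed

definition pseudometric_on :: "'p set \<Rightarrow> ('p \<Rightarrow> 'p \<Rightarrow> real) \<Rightarrow> bool" where
  "pseudometric_on S d \<longleftrightarrow>
     (\<forall>x\<in>S. d x x = 0) \<and> (\<forall>x\<in>S. \<forall>y\<in>S. d x y = d y x) \<and>
     (\<forall>x\<in>S. \<forall>y\<in>S. \<forall>z\<in>S. d x z \<le> d x y + d y z)"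

lemma pseudometric_onD:
  assumes "pseudometric_on S d"
  shows "\<And>x. x \<in> S \<Longrightarrow> d x x = 0"
    and "\<And>x y. x \<in> S \<Longrightarrow> y \<in> S \<Longrightarrow> d x y = d y x"
    and "\<And>x y z. x \<in> S \<Longrightarrow> y \<in> S \<Longrightarrow> z \<in> S \<Longrightarrow> d x z \<le> d x y + d y z"
    and "\<And>x y. x \<in> S \<Longrightarrow> y \<in> S \<Longrightarrow> 0 \<le> d x y"
proof -
  show 1: "\<And>x. x \<in> S \<Longrightarrow> d x x = 0"
    and 2: "\<And>x y. x \<in> S \<Longrightarrow> y \<in> S \<Longrightarrow> d x y = d y x"
    and 3: "\<And>x y z. x \<in> S \<Longrightarrow> y \<in> S \<Longrightarrow> z \<in> S \<Longrightarrow> d x z \<le> d x y + d y z"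
    using assms unfolding pseudometric_on_def by auto
  show "0 \<le> d x y" if "x \<in> S" "y \<in> S" for x y
    using 1[OF that(1)] 2[OF that] 3[OF that that(1)] by linarith
qed

text \<open>The labels in \<open>E\<close> are added one at a time, each by realising its distances
  to the labels already mapped.\<close>

lemma finitely_injective_extend:
  fixes U :: "'u metric" and d :: "'p \<Rightarrow> 'p \<Rightarrow> real"
  assumes U: "Urysohn_metric U" and d: "pseudometric_on S d"
    and "finite F" "finite E" "F \<union> E \<subseteq> S"
    and "\<forall>x\<in>F. h x \<in> mspace U" "\<forall>x\<in>F. \<forall>y\<in>F. mdist U (h x) (h y) = d x y"
  shows "\<exists>h'. (\<forall>x\<in>F. h' x = h x) \<and> (\<forall>x\<in>F \<union> E. h' x \<in> mspace U) \<and>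
     (\<forall>x\<in>F \<union> E. \<forall>y\<in>F \<union> E. mdist U (h' x) (h' y) = d x y)"
  using assms(4,5)
proof (induction E rule: finite_induct)
  case empty
  then show ?case using assms(6,7) by auto
next
  case (insert e E)
  note D = pseudometric_onD[OF d]
  obtain h' where h': "\<forall>x\<in>F. h' x = h x" "\<forall>x\<in>F \<union> E. h' x \<in> mspace U"
      "\<forall>x\<in>F \<union> E. \<forall>y\<in>F \<union> E. mdist U (h' x) (h' y) = d x y"
    using insert by auto
  show ?case
  proof (cases "e \<in> F \<union> E")
    case True
    then show ?thesis using h' by (auto simp: insert_absorb intro!: exI[of _ h'])
  next
    case False
    have FE: "\<And>x. x \<in> F \<union> E \<Longrightarrow> x \<in> S" and e: "e \<in> S" using insert.prems by auto
    \<comment> \<open>Since \<open>d\<close> may vanish between distinct labels, \<open>h'\<close>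
      need not be injective; the distances to be realised are read off at one chosen label of each
      image point.\<close>
    let ?i = "inv_into (F \<union> E) h'"
    have i: "?i s \<in> F \<union> E" "h' (?i s) = s" if "s \<in> h' ` (F \<union> E)" for s
      using inv_into_into[OF that] f_inv_into_f[OF that] by auto
    have i_dist: "mdist U s t = d (?i s) (?i t)"
      if "s \<in> h' ` (F \<union> E)" "t \<in> h' ` (F \<union> E)" for s t
      using i[OF that(1)] i[OF that(2)] h'(3) by metis
    have "\<exists>u\<in>mspace U. \<forall>s\<in>h' ` (F \<union> E). mdist U u s = d e (?i s)"
    proof (rule finitely_injective_one_point[OF U])
      show "finite (h' ` (F \<union> E))" "h' ` (F \<union> E) \<subseteq> mspace U"
        using assms(3) insert.hyps h'(2) by auto
      fix s assume s: "s \<in> h' ` (F \<union> E)"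
      note iS = FE[OF i(1)[OF s]]
      show "0 \<le> d e (?i s)" using D(4) e iS by blast
      fix t assume t: "t \<in> h' ` (F \<union> E)"
      note tS = FE[OF i(1)[OF t]]
      show "d e (?i s) \<le> d e (?i t) + mdist U s t"
        using D(2)[OF iS tS] D(3)[OF e tS iS] i_dist[OF s t] by simp
      show "mdist U s t \<le> d e (?i s) + d e (?i t)"
        using D(2)[OF iS e] D(3)[OF iS e tS] i_dist[OF s t] by simp
    qed
    then obtain u where u: "u \<in> mspace U"
      and ud: "\<And>s. s \<in> h' ` (F \<union> E) \<Longrightarrow> mdist U u s = d e (?i s)"
      by blast
    \<comment> \<open>Labels with the same image are at \<open>d\<close>-distance \<open>0\<close>,
      so the choice of label does not affect the distance to \<open>e\<close>.\<close>
    have ud': "mdist U u (h' x) = d e x" if x: "x \<in> F \<union> E" for x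
    proof -
      have *: "h' x \<in> h' ` (F \<union> E)" using x by blast
      note iS = FE[OF i(1)[OF *]]
      have "d (?i (h' x)) x = 0"
        using i[OF *] h'(3) x D(1)[OF FE] by metis
      then show ?thesis
        using ud[OF *] D(3)[OF e iS FE[OF x]] D(3)[OF e FE[OF x] iS] D(2)[OF FE[OF x] iS] by simp
    qed
    have "(\<forall>x\<in>F. (h'(e := u)) x = h x) \<and> (\<forall>x\<in>F \<union> insert e E. (h'(e := u)) x \<in> mspace U) \<and>
     (\<forall>x\<in>F \<union> insert e E. \<forall>y\<in>F \<union> insert e E. mdist U ((h'(e := u)) x) ((h'(e := u)) y) = d x y)"
      using False h' u ud' e FE D(1,2) by (auto simp: mdist_commute)
    then show ?thesis by blast
  qed
qed

section \<open>Free amalgamation along finitely many legs\<close>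

text \<open>The largest pseudometric extending \<open>d\<close> under which \<open>p\<close> and \<open>x\<close> are at distance at
  most \<open>r\<close> for every leg \<open>(r, x) \<in> L p\<close>. Points already present get the single leg \<open>(0, p)\<close>, so that old and new points
  are treated uniformly.\<close>

definition leg_dist :: "('p \<Rightarrow> 'p \<Rightarrow> real) \<Rightarrow> ('p \<Rightarrow> (real \<times> 'p) set) \<Rightarrow> 'p \<Rightarrow> 'p \<Rightarrow> real" where
  "leg_dist d L p q =
     (if p = q then 0 else Min ((\<lambda>((r, x), (s, y)). r + s + d x y) ` (L p \<times> L q)))"

text \<open>The condition \<open>legs_triangle\<close> forbids shortcuts: going from one old point
  to another through \<open>p\<close> is never shorter than their old distance.\<close>

locale legs =
  fixes S T :: "'p set" and d :: "'p \<Rightarrow> 'p \<Rightarrow> real" and L :: "'p \<Rightarrow> (real \<times> 'p) set"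
  assumes pseudometric: "pseudometric_on S d"
    and finite_legs: "p \<in> T \<Longrightarrow> finite (L p)"
    and legs_nonempty: "p \<in> T \<Longrightarrow> L p \<noteq> {}"
    and leg_end: "p \<in> T \<Longrightarrow> (r, x) \<in> L p \<Longrightarrow> x \<in> S"
    and leg_nonneg: "p \<in> T \<Longrightarrow> (r, x) \<in> L p \<Longrightarrow> 0 \<le> r"
    and legs_triangle: "p \<in> T \<Longrightarrow> (r, x) \<in> L p \<Longrightarrow> (s, y) \<in> L p \<Longrightarrow> d x y \<le> r + s"
begin

lemmas dist = pseudometric_onD[OF pseudometric]

lemma leg_dist_le:
  assumes "p \<in> T" "q \<in> T" "(r, x) \<in> L p" "(s, y) \<in> L q"
  shows "leg_dist d L p q \<le> r + s + d x y"
proof (cases "p = q")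
  case True
  then show ?thesis
    using assms leg_nonneg leg_end dist(4) by (force simp: leg_dist_def intro: add_nonneg_nonneg)
next
  case False
  have "r + s + d x y \<in> (\<lambda>((r, x), (s, y)). r + s + d x y) ` (L p \<times> L q)"
    using assms(3,4) by force
  then show ?thesis
    using False finite_legs[OF assms(1)] finite_legs[OF assms(2)] by (simp add: leg_dist_def)
qed

lemma leg_dist_attained:
  assumes "p \<in> T" "q \<in> T" "p \<noteq> q"
  obtains r x s y where "(r, x) \<in> L p" "(s, y) \<in> L q" "leg_dist d L p q = r + s + d x y"
proof -
  have "leg_dist d L p q \<in> (\<lambda>((r, x), (s, y)). r + s + d x y) ` (L p \<times> L q)"
    using Min_in[of "(\<lambda>((r, x), (s, y)). r + s + d x y) ` (L p \<times> L q)"]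
      assms finite_legs legs_nonempty by (simp add: leg_dist_def)
  then show thesis using that by auto
qed

lemma leg_dist_self [simp]: "leg_dist d L p p = 0"
  by (simp add: leg_dist_def)

lemma leg_dist_commute_le:
  assumes "p \<in> T" "q \<in> T"
  shows "leg_dist d L q p \<le> leg_dist d L p q"
proof (cases "p = q")
  case False
  then obtain r x s y where *: "(r, x) \<in> L p" "(s, y) \<in> L q" "leg_dist d L p q = r + s + d x y"
    using leg_dist_attained assms by metis
  have "d x y = d y x" using dist(2) leg_end assms * by metis
  then show ?thesis using leg_dist_le[OF assms(2,1) *(2,1)] *(3) by simp
qed simp

text \<open>Two optimal paths are joined at \<open>q\<close>. The detour from \<open>y\<close>
  through \<open>q\<close> to \<open>y'\<close> has length \<open>s + s'\<close>, and by
  \<open>legs_triangle\<close> it can be replaced by the old distance \<open>d y y'\<close>.\<close>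

lemma leg_dist_triangle:
  assumes "p \<in> T" "q \<in> T" "w \<in> T"
  shows "leg_dist d L p w \<le> leg_dist d L p q + leg_dist d L q w"
proof (cases "p = q \<or> q = w")
  case False
  obtain r x s y where 1: "(r, x) \<in> L p" "(s, y) \<in> L q" "leg_dist d L p q = r + s + d x y"
    using leg_dist_attained assms False by metis
  obtain s' y' t z where 2: "(s', y') \<in> L q" "(t, z) \<in> L w" "leg_dist d L q w = s' + t + d y' z"
    using leg_dist_attained assms False by metis
  have S: "x \<in> S" "y \<in> S" "y' \<in> S" "z \<in> S" using leg_end assms 1 2 by metis+
  have "leg_dist d L p w \<le> r + t + d x z" using leg_dist_le assms 1 2 by blast
  also have "d x z \<le> d x y + d y y' + d y' z"
    using dist(3)[OF S(1,2,4)] dist(3)[OF S(2,3,4)] by linarith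
  also have "d y y' \<le> s + s'" using legs_triangle assms 1 2 by blast
  finally show ?thesis using 1 2 by simp
qed auto

lemma pseudometric_leg_dist: "pseudometric_on T (leg_dist d L)"
  unfolding pseudometric_on_def
  using leg_dist_commute_le leg_dist_triangle by (auto intro: antisym)

lemma leg_dist_base:
  assumes "p \<in> S" "L p = {(0, p)}" "L q = {(0, q)}"
  shows "leg_dist d L p q = d p q"
  using assms dist(1)[of p] by (cases "p = q") (simp_all add: leg_dist_def)

end

section \<open>Equivariant amalgamation and asymptotic displacement\<close>

text \<open>A point is an orbit together with a position in it, and the isometry is the shift by \<open>1\<close>.
  Distances are only pseudometrics, so an orbit may collapse to a fixed point: this is how the
  points of \<open>X\<close> appear, as the orbits \<open>Inl i\<close>. The orbit \<open>Inr k\<close> is added at stage \<open>k\<close>.\<close>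

type_synonym point = "(nat + nat) \<times> int"

definition shift :: "int \<Rightarrow> point \<Rightarrow> point" where
  "shift m p = (fst p, snd p + m)"

lemma shift_simps [simp]:
  "shift 0 p = p" "shift m (shift n p) = shift (n + m) p" "fst (shift m p) = fst p"
  "shift m p = shift n p \<longleftrightarrow> m = n" "shift m p = shift m q \<longleftrightarrow> p = q"
  by (auto simp: shift_def prod_eq_iff)

text \<open>The lower bound \<open>\<rho>\<close> on the asymptotic displacement stands for the distance to the fixed
  set \<open>G\<close>, and for \<open>1/2\<close> where \<open>G\<close> gives no information because it is empty.\<close>

definition mixing :: "point set \<Rightarrow> point set \<Rightarrow> (point \<Rightarrow> point \<Rightarrow> real) \<Rightarrow> bool" where
  "mixing G S d \<longleftrightarrow> (\<exists>\<rho>. (\<forall>p\<in>S. 1/2 \<le> \<rho> p \<or> (\<exists>g\<in>G. d p g \<le> \<rho> p)) \<and>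
     (\<forall>p\<in>S. \<forall>q\<in>S. \<exists>N. \<forall>m\<ge>N. \<rho> p + \<rho> q \<le> d p (shift m q)))"

locale shift_legs = legs S T d L for S T :: "point set" and d L +
  assumes shift_T: "p \<in> T \<Longrightarrow> shift m p \<in> T"
    and shift_legs: "L (shift m p) = (\<lambda>(r, x). (r, shift m x)) ` L p"
    and shift_invariant: "x \<in> S \<Longrightarrow> y \<in> S \<Longrightarrow> d (shift m x) (shift m y) = d x y"
begin

lemma leg_dist_shift_le:
  assumes "p \<in> T" "q \<in> T"
  shows "leg_dist d L (shift m p) (shift m q) \<le> leg_dist d L p q"
proof (cases "p = q")
  case False
  then obtain r x s y where *: "(r, x) \<in> L p" "(s, y) \<in> L q" "leg_dist d L p q = r + s + d x y"
    using leg_dist_attained assms by metis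
  have "(r, shift m x) \<in> L (shift m p)" "(s, shift m y) \<in> L (shift m q)"
    using * by (force simp: shift_legs)+
  then have "leg_dist d L (shift m p) (shift m q) \<le> r + s + d (shift m x) (shift m y)"
    using leg_dist_le shift_T assms by blast
  also have "d (shift m x) (shift m y) = d x y"
    using shift_invariant leg_end assms * by blast
  finally show ?thesis using * by simp
qed simp

lemma leg_dist_shift:
  assumes "p \<in> T" "q \<in> T"
  shows "leg_dist d L (shift m p) (shift m q) = leg_dist d L p q"
  using leg_dist_shift_le[OF assms, of m]
    leg_dist_shift_le[of "shift m p" "shift m q" "- m"] shift_T assms
  by simp

text \<open>A shortest path from \<open>p\<close> to \<open>shift m q\<close> is a leg to
  \<open>x\<close>, an old distance, and a leg from \<open>shift m y\<close>. For large
  \<open>m\<close> the old distance is at least \<open>\<rho> x + \<rho> y\<close>, so the bound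
  passes to \<open>T\<close> when \<open>\<rho>'\<close> is the cheapest leg length plus bound.
  There are only finitely many pairs of legs, so one threshold for \<open>m\<close> serves them
  all.\<close>

lemma mixing_leg_dist:
  assumes mixing: "mixing G S d" and G: "G \<subseteq> T" "\<And>g. g \<in> G \<Longrightarrow> L g = {(0, g)}"
  shows "mixing G T (leg_dist d L)"
proof -
  obtain \<rho> where \<rho>: "\<And>p. p \<in> S \<Longrightarrow> 1/2 \<le> \<rho> p \<or> (\<exists>g\<in>G. d p g \<le> \<rho> p)"
    and "\<forall>p\<in>S. \<forall>q\<in>S. \<exists>N. \<forall>m\<ge>N. \<rho> p + \<rho> q \<le> d p (shift m q)"
    using mixing unfolding mixing_def by blast
  then obtain N where N: "\<And>p q m. p \<in> S \<Longrightarrow> q \<in> S \<Longrightarrow> m \<ge> N p q \<Longrightarrow> \<rho> p + \<rho> q \<le> d p (shift m q)"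
    by metis
  define \<rho>' where "\<rho>' p = Min ((\<lambda>(r, x). r + \<rho> x) ` L p)" for p
  have \<rho>'_le: "\<rho>' p \<le> r + \<rho> x" if "p \<in> T" "(r, x) \<in> L p" for p r x
    unfolding \<rho>'_def
  proof (rule Min_le)
    show "finite ((\<lambda>(r, x). r + \<rho> x) ` L p)" using finite_legs[OF that(1)] by simp
    show "r + \<rho> x \<in> (\<lambda>(r, x). r + \<rho> x) ` L p" using that(2) by force
  qed
  have "1/2 \<le> \<rho>' p \<or> (\<exists>g\<in>G. leg_dist d L p g \<le> \<rho>' p)" if p: "p \<in> T" for p
  proof -
    have "\<rho>' p \<in> (\<lambda>(r, x). r + \<rho> x) ` L p"
      unfolding \<rho>'_def using p finite_legs legs_nonempty using Min_in[of "(\<lambda>(r, x). r + \<rho> x) ` L p"] by simp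
    then obtain r x where rx: "(r, x) \<in> L p" "\<rho>' p = r + \<rho> x" by auto
    have "r \<ge> 0" "x \<in> S" using leg_nonneg leg_end p rx by blast+
    from \<rho>[OF \<open>x \<in> S\<close>] show ?thesis
    proof
      assume "\<exists>g\<in>G. d x g \<le> \<rho> x"
      then obtain g where g: "g \<in> G" "d x g \<le> \<rho> x" by blast
      have "leg_dist d L p g \<le> r + 0 + d x g"
        using leg_dist_le[OF p _ rx(1), of g 0 g] G g by auto
      then show ?thesis using g rx by force
    qed (use rx \<open>r \<ge> 0\<close> in simp)
  qed
  moreover have "\<exists>N'. \<forall>m\<ge>N'. \<rho>' p + \<rho>' q \<le> leg_dist d L p (shift m q)"
    if p: "p \<in> T" and q: "q \<in> T" for p q
  proof -
    \<comment> \<open>The extra threshold ensures \<open>p \<noteq> shift m q\<close>; for equal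
      points \<open>leg_dist\<close> is \<open>0\<close> by definition and no path is
      available.\<close>
    let ?A = "insert (snd p - snd q + 1) ((\<lambda>((r, x), (s, y)). N x y) ` (L p \<times> L q))"
    have "finite ?A" using finite_legs p q by auto
    then have A: "a \<le> Max ?A" if "a \<in> ?A" for a using that Max_ge by blast
    have "\<rho>' p + \<rho>' q \<le> leg_dist d L p (shift m q)" if m: "m \<ge> Max ?A" for m
    proof -
      have "m \<ge> snd p - snd q + 1" using A[of "snd p - snd q + 1"] m by auto
      then have "p \<noteq> shift m q" by (auto simp: shift_def)
      then obtain r x s y' where 1: "(r, x) \<in> L p" "(s, y') \<in> L (shift m q)"
        "leg_dist d L p (shift m q) = r + s + d x y'"
        using leg_dist_attained p q shift_T by metis
      then obtain y where y: "(s, y) \<in> L q" "y' = shift m y" by (auto simp: shift_legs)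
      have "N x y \<in> ?A" using 1 y by force
      then have "m \<ge> N x y" using A m by (meson order_trans)
      then have "\<rho> x + \<rho> y \<le> d x y'" using N leg_end 1 y p q by blast
      then show ?thesis using \<rho>'_le[OF p 1(1)] \<rho>'_le[OF q y(1)] 1(3) by linarith
    qed
    then show ?thesis by blast
  qed
  ultimately show ?thesis unfolding mixing_def by blast
qed

end

section \<open>Stages of the construction\<close>

definition carrier :: "nat \<Rightarrow> point set" where
  "carrier n = {p. \<forall>k. fst p = Inr k \<longrightarrow> k < n}"

definition stage :: "point set \<Rightarrow> nat \<Rightarrow> (point \<Rightarrow> point \<Rightarrow> real) \<Rightarrow> bool" where
  "stage G n d \<longleftrightarrow> pseudometric_on (carrier n) d \<and>
     (\<forall>m. \<forall>p\<in>carrier n. \<forall>q\<in>carrier n. d (shift m p) (shift m q) = d p q) \<and>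
     mixing G (carrier n) d"

lemma shift_carrier [simp]: "shift m p \<in> carrier n \<longleftrightarrow> p \<in> carrier n"
  by (simp add: carrier_def)

lemma carrier_mono: "m \<le> n \<Longrightarrow> carrier m \<subseteq> carrier n"
  by (auto simp: carrier_def)

text \<open>The new orbit is attached by legs of length \<open>f a\<close> to the points of
  \<open>F\<close>. Here \<open>tri\<close> gives \<open>legs_triangle\<close>, and
  \<open>lip\<close> prevents a leg to another point of \<open>F\<close> from undercutting
  \<open>f a\<close>, so that the prescribed distances are exactly attained. Nonemptiness of
  \<open>F\<close> provides at least one leg.\<close>

lemma add_orbit:
  assumes stage: "stage G n d" and G: "G \<subseteq> carrier 0"
    and F: "finite F" "F \<noteq> {}" "F \<subseteq> carrier n"
    and nonneg: "\<And>a. a \<in> F \<Longrightarrow> 0 \<le> f a"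
    and lip: "\<And>a b. a \<in> F \<Longrightarrow> b \<in> F \<Longrightarrow> f a \<le> f b + d a b"
    and tri: "\<And>a b. a \<in> F \<Longrightarrow> b \<in> F \<Longrightarrow> d a b \<le> f a + f b"
  obtains d' where "stage G (Suc n) d'"
    and "\<And>p q. p \<in> carrier n \<Longrightarrow> q \<in> carrier n \<Longrightarrow> d' p q = d p q"
    and "\<And>a. a \<in> F \<Longrightarrow> d' (Inr n, 0) a = f a"
proof -
  \<comment> \<open>Position \<open>snd p\<close> of the new orbit gets the legs of position
    \<open>0\<close> shifted along, as equivariance dictates.\<close>
  define L where "L p = (if fst p = Inr n then (\<lambda>a. (f a, shift (snd p) a)) ` F else {(0, p)})"
    for p :: point
  have pd: "pseudometric_on (carrier n) d"
    and inv: "\<And>m p q. p \<in> carrier n \<Longrightarrow> q \<in> carrier n \<Longrightarrow> d (shift m p) (shift m q) = d p q"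
    and mix: "mixing G (carrier n) d"
    using stage unfolding stage_def by auto
  note D = pseudometric_onD[OF pd]
  have FC: "\<And>a. a \<in> F \<Longrightarrow> a \<in> carrier n" using F(3) by blast
  have old: "p \<in> carrier n" if "p \<in> carrier (Suc n)" "fst p \<noteq> Inr n" for p
    using that by (auto simp: carrier_def less_Suc_eq)
  have L_old: "L p = {(0, p)}" if "p \<in> carrier n" for p
    using that by (auto simp: carrier_def L_def)
  interpret shift_legs "carrier n" "carrier (Suc n)" d L
  proof
    show "pseudometric_on (carrier n) d" by (rule pd)
    fix p :: point and m
    show "L (shift m p) = (\<lambda>(r, x). (r, shift m x)) ` L p"
      by (auto simp: L_def image_image) (auto simp: shift_def)
    assume p: "p \<in> carrier (Suc n)"
    show "finite (L p)" "L p \<noteq> {}" using F by (auto simp: L_def)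
    show "shift m p \<in> carrier (Suc n)" using p by simp
    fix r x assume rx: "(r, x) \<in> L p"
    show "x \<in> carrier n" "0 \<le> r"
      using rx old[OF p] FC nonneg by (auto simp: L_def split: if_splits)
    fix s y assume sy: "(s, y) \<in> L p"
    show "d x y \<le> r + s"
    proof (cases "fst p = Inr n")
      case True
      then show ?thesis using rx sy tri inv FC by (auto simp: L_def)
    next
      case False
      then show ?thesis using rx sy old[OF p] D(1) by (auto simp: L_def)
    qed
  qed (rule inv)
  show thesis
  proof
    have "G \<subseteq> carrier (Suc n)" "G \<subseteq> carrier n"
      using G carrier_mono[of 0 "Suc n"] carrier_mono[of 0 n] by auto
    then have "mixing G (carrier (Suc n)) (leg_dist d L)"
      using mixing_leg_dist[OF mix] L_old by blast
    then show "stage G (Suc n) (leg_dist d L)"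
      unfolding stage_def using pseudometric_leg_dist leg_dist_shift by blast
    show "leg_dist d L p q = d p q" if "p \<in> carrier n" "q \<in> carrier n" for p q
      using leg_dist_base L_old that by blast
    show "leg_dist d L (Inr n, 0) a = f a" if a: "a \<in> F" for a
    proof (rule antisym)
      have new: "(Inr n, 0) \<in> carrier (Suc n)" by (simp add: carrier_def)
      have aS: "a \<in> carrier (Suc n)" using FC[OF a] carrier_mono[of n "Suc n"] by auto
      have La: "L a = {(0, a)}" using L_old FC a by blast
      have Ln: "L (Inr n, 0) = (\<lambda>a. (f a, a)) ` F" by (simp add: L_def)
      show "leg_dist d L (Inr n, 0) a \<le> f a"
        using leg_dist_le[OF new aS, of "f a" a 0 a] La Ln a D(1)[OF FC[OF a]] by auto
      have "(Inr n, 0) \<noteq> a" using FC[OF a] by (auto simp: carrier_def)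
      from leg_dist_attained[OF new aS this] obtain r x s y where
        *: "(r, x) \<in> L (Inr n, 0)" "(s, y) \<in> L a" "leg_dist d L (Inr n, 0) a = r + s + d x y"
        by blast
      then have "x \<in> F" "r = f x" "s = 0" "y = a" by (auto simp: La Ln)
      then show "f a \<le> leg_dist d L (Inr n, 0) a"
        using *(3) lip[OF a, of x] D(2)[OF FC FC, of a x] a by simp
    qed
  qed
qed

section \<open>The back-and-forth construction\<close>

text \<open>The pseudometric covers all of the infinite set \<open>carrier n\<close>, but
  \<open>h\<close> is isometric only on a finite \<open>F\<close>, because finite injectivity
  realises finitely many distances at a time.\<close>

definition approx ::
  "'u metric \<Rightarrow> point set \<Rightarrow> nat \<Rightarrow> (point \<Rightarrow> point \<Rightarrow> real) \<times> point set \<times> (point \<Rightarrow> 'u) \<Rightarrow> bool"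
  where "approx U G n = (\<lambda>(d, F, h). stage G n d \<and> finite F \<and> F \<subseteq> carrier n \<and>
     (\<forall>x\<in>F. h x \<in> mspace U) \<and> (\<forall>x\<in>F. \<forall>y\<in>F. mdist U (h x) (h y) = d x y))"

text \<open>Hitting \<open>u\<close> is the back step. The clause with \<open>to_nat\<close> is the
  forth step: it brings every label into the domain sooner or later.\<close>

definition extends ::
  "nat \<Rightarrow> 'u \<Rightarrow> (point \<Rightarrow> point \<Rightarrow> real) \<times> point set \<times> (point \<Rightarrow> 'u) \<Rightarrow>
    (point \<Rightarrow> point \<Rightarrow> real) \<times> point set \<times> (point \<Rightarrow> 'u) \<Rightarrow> bool"
  where "extends n u = (\<lambda>(d, F, h) (d', F', h').
     (\<forall>p\<in>carrier n. \<forall>q\<in>carrier n. d' p q = d p q) \<and> F \<subseteq> F' \<and> (\<forall>x\<in>F. h' x = h x) \<and>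
     u \<in> h' ` F' \<and> (\<forall>p\<in>carrier n. to_nat p \<le> n \<longrightarrow> p \<in> F'))"

text \<open>First \<open>h\<close> is extended to the labels due at this stage. By the triangle
  inequality in \<open>U\<close> the distances from \<open>u\<close> to the images form a Katetov
  function, which is prescribed to the new orbit; its position \<open>0\<close> can then be mapped
  to \<open>u\<close>.\<close>

lemma approx_step:
  fixes U :: "'u metric"
  assumes U: "Urysohn_metric U" and G: "G \<subseteq> carrier 0" and A: "approx U G n A" and u: "u \<in> mspace U"
  shows "\<exists>A'. approx U G (Suc n) A' \<and> extends n u A A'"
proof -
  obtain d F h where A_eq: "A = (d, F, h)" by (cases A)
  have stage: "stage G n d" and F: "finite F" "F \<subseteq> carrier n"
    and h: "\<forall>x\<in>F. h x \<in> mspace U" "\<forall>x\<in>F. \<forall>y\<in>F. mdist U (h x) (h y) = d x y"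
    using A by (auto simp: approx_def A_eq)
  have pd: "pseudometric_on (carrier n) d" using stage by (simp add: stage_def)
  \<comment> \<open>The label \<open>(Inl 0, 0)\<close>, present in every carrier, makes
    \<open>F \<union> E\<close> nonempty, as \<open>add_orbit\<close> requires.\<close>
  define E where "E = insert (Inl 0, 0) (from_nat ` {..n} \<inter> carrier n)"
  have E: "finite E" "F \<union> E \<subseteq> carrier n" using F by (auto simp: E_def carrier_def)
  obtain h' where h': "\<forall>x\<in>F. h' x = h x" "\<forall>x\<in>F \<union> E. h' x \<in> mspace U"
     "\<forall>x\<in>F \<union> E. \<forall>y\<in>F \<union> E. mdist U (h' x) (h' y) = d x y"
    using finitely_injective_extend[OF U pd F(1) E h] by blast
  obtain d' where d': "stage G (Suc n) d'"
    and old: "\<And>p q. p \<in> carrier n \<Longrightarrow> q \<in> carrier n \<Longrightarrow> d' p q = d p q"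
    and new: "\<And>a. a \<in> F \<union> E \<Longrightarrow> d' (Inr n, 0) a = mdist U u (h' a)"
  proof (rule add_orbit[OF stage G, of "F \<union> E" "\<lambda>a. mdist U u (h' a)"])
    show "finite (F \<union> E)" "F \<union> E \<noteq> {}" "F \<union> E \<subseteq> carrier n" using F E by (auto simp: E_def)
    fix a b assume ab: "a \<in> F \<union> E" "b \<in> F \<union> E"
    have M: "h' a \<in> mspace U" "h' b \<in> mspace U" "mdist U (h' a) (h' b) = d a b"
      using ab h' by blast+
    show "mdist U u (h' a) \<le> mdist U u (h' b) + d a b"
      "d a b \<le> mdist U u (h' a) + mdist U u (h' b)"
      using mdist_triangle[OF u M(2,1)] mdist_triangle[OF M(1) u M(2)] M(3)
      by (simp_all add: mdist_commute)
  qed auto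
  let ?z = "(Inr n, 0) :: point"
  have z: "?z \<notin> F \<union> E" "?z \<in> carrier (Suc n)" using E by (auto simp: carrier_def)
  have sub: "F \<union> E \<subseteq> carrier (Suc n)" using E(2) carrier_mono[of n "Suc n"] by auto
  have "pseudometric_on (carrier (Suc n)) d'" using d' by (simp add: stage_def)
  note D' = pseudometric_onD[OF this]
  have "d' x ?z = mdist U u (h' x)" if "x \<in> F \<union> E" for x
    using new[OF that] D'(2)[OF _ z(2), of x] sub that by auto
  moreover have "d' x y = d x y" if "x \<in> F \<union> E" "y \<in> F \<union> E" for x y
    using old E that by blast
  ultimately have "approx U G (Suc n) (d', insert ?z (F \<union> E), h'(?z := u))"
    unfolding approx_def using d' F E z sub h' new D'(1)[OF z(2)] u
    by (auto simp: mdist_commute)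
  moreover have "p \<in> E" if "p \<in> carrier n" "to_nat p \<le> n" for p
    unfolding E_def using that by (metis IntI atMost_iff from_nat_to_nat image_eqI insertCI)
  then have "extends n u A (d', insert ?z (F \<union> E), h'(?z := u))"
    unfolding extends_def A_eq using old h' z by auto
  ultimately show ?thesis by blast
qed

text \<open>Once defined, distances between labels and values of the partial maps never change, so
  the stages have a common limit. The displacement clause concerns a single label \<open>p\<close>,
  and the bound \<open>\<rho>\<close> of one stage containing \<open>p\<close> suffices for
  it.\<close>

lemma dense_point_map:
  fixes U :: "'u metric"
  and u :: "nat \<Rightarrow> 'u"
  assumes U: "Urysohn_metric U" and G: "G \<subseteq> carrier 0" and d0: "stage G 0 d0"
    and u: "\<And>n. u n \<in> mspace U"
  obtains h :: "point \<Rightarrow> 'u" where "\<And>p. h p \<in> mspace U" and "\<And>n. u n \<in> range h"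
    and "\<And>p q m. mdist U (h (shift m p)) (h (shift m q)) = mdist U (h p) (h q)"
    and "\<And>p q. p \<in> carrier 0 \<Longrightarrow> q \<in> carrier 0 \<Longrightarrow> mdist U (h p) (h q) = d0 p q"
    and "\<And>p. \<exists>m r. 2 * r \<le> mdist U (h p) (h (shift m p)) \<and>
           (1/2 \<le> r \<or> (\<exists>g\<in>G. mdist U (h p) (h g) \<le> r))"
proof -
  have "\<exists>A. \<forall>n. (approx U G n (A n) \<and> (n = 0 \<longrightarrow> fst (A n) = d0)) \<and> extends n (u n) (A n) (A (Suc n))"
  proof (rule dependent_nat_choice)
    show "\<exists>A. approx U G 0 A \<and> (0 = (0::nat) \<longrightarrow> fst A = d0)"
      using d0 by (intro exI[of _ "(d0, {}, undefined)"]) (simp add: approx_def)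
    show "\<exists>A'. (approx U G (Suc n) A' \<and> (Suc n = 0 \<longrightarrow> fst A' = d0)) \<and> extends n (u n) A A'"
      if "approx U G n A \<and> (n = 0 \<longrightarrow> fst A = d0)" for A n
      using approx_step[OF U G _ u] that by auto
  qed
  then obtain A where A: "\<And>n. approx U G n (A n)" "fst (A 0) = d0"
    "\<And>n. extends n (u n) (A n) (A (Suc n))"
    by metis
  define d F h where "d n = fst (A n)" and "F n = fst (snd (A n))" and "h n = snd (snd (A n))" for n
  have A_eq: "A n = (d n, F n, h n)" for n by (simp add: d_def F_def h_def)
  have stage: "stage G n (d n)" and hU: "\<And>x. x \<in> F n \<Longrightarrow> h n x \<in> mspace U"
    and hd: "\<And>x y. x \<in> F n \<Longrightarrow> y \<in> F n \<Longrightarrow> mdist U (h n x) (h n y) = d n x y" for n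
    using A(1)[of n] by (auto simp: A_eq approx_def)
  have d_Suc: "\<And>p q. p \<in> carrier n \<Longrightarrow> q \<in> carrier n \<Longrightarrow> d (Suc n) p q = d n p q"
    and F_Suc: "F n \<subseteq> F (Suc n)" and h_Suc: "\<And>x. x \<in> F n \<Longrightarrow> h (Suc n) x = h n x"
    and u_Suc: "u n \<in> h (Suc n) ` F (Suc n)"
    and enum_Suc: "\<And>p. p \<in> carrier n \<Longrightarrow> to_nat p \<le> n \<Longrightarrow> p \<in> F (Suc n)" for n
    using A(3)[of n] by (auto simp: A_eq extends_def)
  have d_stable: "d n p q = d m p q" if "m \<le> n" "p \<in> carrier m" "q \<in> carrier m" for m n p q
    using that(1)
  proof (induction rule: dec_induct)
    case (step k)
    then show ?case using d_Suc[of p k q] carrier_mono[of m k] that by auto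
  qed simp
  have h_stable: "p \<in> F n \<and> h n p = h m p" if "m \<le> n" "p \<in> F m" for m n p
    using that(1)
  proof (induction rule: dec_induct)
    case (step k)
    then show ?case using F_Suc[of k] h_Suc[of p k] by auto
  qed (simp add: that)
  have carrier: "p \<in> carrier (case fst p of Inl _ \<Rightarrow> 0 | Inr k \<Rightarrow> Suc k)" for p
    by (auto simp: carrier_def)
  have "\<exists>n. p \<in> F n \<and> p \<in> carrier n" for p
  proof -
    obtain k where k: "p \<in> carrier k" using carrier by blast
    let ?n = "max k (to_nat p)"
    have "p \<in> carrier ?n" using k carrier_mono[of k ?n] by auto
    then show ?thesis using enum_Suc[of p ?n] carrier_mono[of ?n "Suc ?n"] by fastforce
  qed
  then obtain N where N: "\<And>p. p \<in> F (N p)" "\<And>p. p \<in> carrier (N p)" by metis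
  define H where "H p = h (N p) p" for p
  have H: "p \<in> F n" "H p = h n p" if "N p \<le> n" for p n
    using h_stable[OF that N(1)] by (auto simp: H_def)
  have Hd: "mdist U (H p) (H q) = d n p q" if "N p \<le> n" "N q \<le> n" for p q n
    using hd H that by metis
  have C: "p \<in> carrier n" if "N p \<le> n" for p n using N(2) carrier_mono[OF that] by blast
  show thesis
  proof
    show "H p \<in> mspace U" for p using hU N by (simp add: H_def)
    show "u n \<in> range H" for n
    proof -
      obtain p where p: "p \<in> F (Suc n)" "u n = h (Suc n) p" using u_Suc by blast
      let ?k = "max (Suc n) (N p)"
      have "H p = h ?k p" using H by simp
      also have "\<dots> = h (Suc n) p" using h_stable[OF _ p(1), of ?k] by simp
      finally show ?thesis using p(2) by (metis rangeI)
    qed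
    show "mdist U (H (shift m p)) (H (shift m q)) = mdist U (H p) (H q)" for p q m
    proof -
      let ?n = "Max {N p, N q, N (shift m p), N (shift m q)}"
      have n: "N p \<le> ?n" "N q \<le> ?n" "N (shift m p) \<le> ?n" "N (shift m q) \<le> ?n" by simp_all
      show ?thesis
        using Hd[OF n(3,4)] Hd[OF n(1,2)] stage[of ?n] C[OF n(1)] C[OF n(2)]
        unfolding stage_def by metis
    qed
    show "mdist U (H p) (H q) = d0 p q" if "p \<in> carrier 0" "q \<in> carrier 0" for p q
    proof -
      let ?n = "max (N p) (N q)"
      have "mdist U (H p) (H q) = d ?n p q" by (rule Hd) auto
      also have "\<dots> = d 0 p q" using d_stable that by blast
      finally show ?thesis using A(2) by (simp add: d_def)
    qed
    show "\<exists>m r. 2 * r \<le> mdist U (H p) (H (shift m p)) \<and>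
           (1/2 \<le> r \<or> (\<exists>g\<in>G. mdist U (H p) (H g) \<le> r))" for p
    proof -
      let ?n = "N p"
      \<comment> \<open>Mixing is used for the pair \<open>p\<close>, \<open>p\<close>, and
        \<open>r\<close> will be \<open>\<rho> p\<close>.\<close>
      obtain \<rho> where \<rho>: "1/2 \<le> \<rho> p \<or> (\<exists>g\<in>G. d ?n p g \<le> \<rho> p)"
        and "\<exists>M. \<forall>m\<ge>M. \<rho> p + \<rho> p \<le> d ?n p (shift m p)"
        using stage[of ?n] N(2)[of p] unfolding stage_def mixing_def by blast
      then obtain m where m: "2 * \<rho> p \<le> d ?n p (shift m p)" by fastforce
      have dist: "mdist U (H p) (H q) = d ?n p q" if "q \<in> carrier ?n" for q
      proof -
        let ?k = "max ?n (N q)"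
        have "mdist U (H p) (H q) = d ?k p q" by (rule Hd) auto
        then show ?thesis using d_stable[OF _ N(2) that, of ?k] by simp
      qed
      have "G \<subseteq> carrier ?n" using G carrier_mono[of 0 ?n] by auto
      then have "1/2 \<le> \<rho> p \<or> (\<exists>g\<in>G. mdist U (H p) (H g) \<le> \<rho> p)"
        using \<rho> dist by (metis subsetD)
      moreover have "2 * \<rho> p \<le> mdist U (H p) (H (shift m p))"
        using m dist[of "shift m p"] N(2) by simp
      ultimately show ?thesis by blast
    qed
  qed
qed

section \<open>Dense sequences and the two initial stages\<close>

lemma separable_sequence:
  assumes "separable_metric M" "mspace M \<noteq> {}"
  obtains x :: "nat \<Rightarrow> 'a" where "\<And>n. x n \<in> mspace M"
    and "\<And>p e. p \<in> mspace M \<Longrightarrow> e > 0 \<Longrightarrow> \<exists>n. mdist M (x n) p < e"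
proof -
  interpret M: Metric_space "mspace M" "mdist M" by simp
  obtain C where C: "countable C" "C \<subseteq> mspace M" "M.mtopology closure_of C = mspace M"
    using assms(1) unfolding separable_metric_def mtopology_of_def by blast
  have near: "\<exists>y\<in>C. mdist M y p < e" if "p \<in> mspace M" "e > 0" for p e
    using that C(3) unfolding M.metric_closure_of by (force simp: mdist_commute)
  then have "C \<noteq> {}" using assms(2) zero_less_one by blast
  show thesis
  proof
    show "from_nat_into C n \<in> mspace M" for n using from_nat_into[OF \<open>C \<noteq> {}\<close>] C(2) by blast
    show "\<exists>n. mdist M (from_nat_into C n) p < e" if p: "p \<in> mspace M" "e > 0" for p e
      using near[OF p] from_nat_into_surj[OF C(1)] by metis
  qed
qed

text \<open>The label \<open>(Inl i, k)\<close> stands for \<open>x i\<close> whatever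
  \<open>k\<close> is, so the shift moves nothing by a positive distance. Every label is its own
  witness in \<open>G\<close>, which allows \<open>\<rho> = 0\<close>.\<close>

lemma stage_of_sequence:
  assumes "\<And>i. x i \<in> mspace X"
  shows "stage (carrier 0) 0 (\<lambda>p q. mdist X (x (projl (fst p))) (x (projl (fst q))))"
  unfolding stage_def
proof (intro conjI)
  show "mixing (carrier 0) (carrier 0) (\<lambda>p q. mdist X (x (projl (fst p))) (x (projl (fst q))))"
    unfolding mixing_def using assms by (intro exI[of _ "\<lambda>_. 0"]) (auto intro!: bexI mdist_zero[THEN iffD2, THEN eq_refl])
qed (use assms in \<open>auto simp: pseudometric_on_def mdist_commute intro: mdist_triangle\<close>)

text \<open>This is the start for empty \<open>X\<close>: with \<open>G\<close> empty,
  \<open>\<rho>\<close> is constantly \<open>1/2\<close>, and \<open>p\<close> is at distance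
  \<open>1\<close> from \<open>shift m q\<close> as soon as they differ, hence for all large
  \<open>m\<close>.\<close>

lemma stage_discrete: "stage {} 0 (\<lambda>p q. if p = q then 0 else 1)"
  unfolding stage_def
proof (intro conjI)
  have "\<exists>N. \<forall>m\<ge>N. 1/2 + 1/2 \<le> (if p = shift m q then 0 else 1 :: real)" for p q
    by (rule exI[of _ "snd p - snd q + 1"]) (auto simp: shift_def)
  then show "mixing {} (carrier 0) (\<lambda>p q. if p = q then 0 else 1)"
    unfolding mixing_def by (intro exI[of _ "\<lambda>_. 1/2"]) auto
qed (auto simp: pseudometric_on_def)

section \<open>The extended isometry and its fixed points\<close>

text \<open>The range of \<open>\<phi>\<close> is dense because the shift is invertible, and closed
  by completeness. If \<open>w\<close> is fixed and \<open>h p\<close> is close to \<open>w\<close>,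
  the whole orbit of \<open>p\<close> stays equally close, so its displacement is small;
  \<open>disp\<close> then puts a point of \<open>G\<close> near \<open>p\<close>, hence near
  \<open>w\<close>.\<close>

lemma isometry_of_point_map:
  fixes U :: "'u metric" and h :: "point \<Rightarrow> 'u"
  assumes U: "mcomplete_of U"
    and h: "\<And>p. h p \<in> mspace U"
    and dense: "\<And>w e. w \<in> mspace U \<Longrightarrow> e > 0 \<Longrightarrow> \<exists>p. mdist U (h p) w < e"
    and shift: "\<And>p q m. mdist U (h (shift m p)) (h (shift m q)) = mdist U (h p) (h q)"
    and disp: "\<And>p. \<exists>m r. 2 * r \<le> mdist U (h p) (h (shift m p)) \<and>
           (1/2 \<le> r \<or> (\<exists>g\<in>G. mdist U (h p) (h g) \<le> r))"
  obtains \<phi> where "isometry_onto U U \<phi>" and "\<And>p. \<phi> (h p) = h (shift 1 p)"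
    and "\<And>w e. w \<in> Fix U \<phi> \<Longrightarrow> e > 0 \<Longrightarrow> \<exists>g\<in>G. mdist U (h g) w < e"
proof -
  obtain \<phi> where \<phi>: "isometric_embedding U U \<phi>" "\<And>p. \<phi> (h p) = h (shift 1 p)"
    using isometric_extension[of U h U "\<lambda>p. h (shift 1 p)"] U h dense shift by metis
  have \<phi>U: "\<And>x. x \<in> mspace U \<Longrightarrow> \<phi> x \<in> mspace U"
    and \<phi>d: "\<And>x y. x \<in> mspace U \<Longrightarrow> y \<in> mspace U \<Longrightarrow> mdist U (\<phi> x) (\<phi> y) = mdist U x y"
    using \<phi>(1) unfolding isometric_embedding_def by auto
  have "w \<in> \<phi> ` mspace U" if w: "w \<in> mspace U" for w
  proof (rule isometric_embedding_range[OF U \<phi>(1) h w])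
    fix e :: real assume "e > 0"
    then obtain p where "mdist U (h p) w < e" using dense w by blast
    then have "mdist U (\<phi> (h (shift (- 1) p))) w < e" by (simp add: \<phi>(2))
    then show "\<exists>p. mdist U (\<phi> (h p)) w < e" by blast
  qed
  then have onto: "isometry_onto U U \<phi>" unfolding isometry_onto_def using \<phi>(1) \<phi>U by auto
  have "\<exists>g\<in>G. mdist U (h g) w < e" if fixed: "w \<in> Fix U \<phi>" and e: "e > 0" for w e
  proof -
    have w: "w \<in> mspace U" "\<phi> w = w" using fixed by (auto simp: Fix_def)
    have step: "mdist U (h (shift 1 p)) w = mdist U (h p) w" for p
      using \<phi>d[OF h w(1), of p] \<phi>(2) w by simp
    have orbit: "mdist U (h (shift m p)) w = mdist U (h p) w" for m p
    proof (induction m rule: int_induct[of _ 0])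
      case (step1 i)
      then show ?case using step[of "shift i p"] by simp
    next
      case (step2 i)
      then show ?case using step[of "shift (i - 1) p"] by simp
    qed simp
    \<comment> \<open>The bound \<open>1 / 4\<close> rules out the alternative
      \<open>1/2 \<le> r\<close>; the bound \<open>e / 2\<close> leaves room for the two distances
      \<open>h g\<close> to \<open>h p\<close> and \<open>h p\<close> to \<open>w\<close>.\<close>
    define c where "c = min (e / 2) (1 / 4)"
    have c: "c > 0" "2 * c \<le> e" "c < 1/2" using e by (auto simp: c_def)
    obtain p where p: "mdist U (h p) w < c" using dense w c by blast
    obtain m r where r: "2 * r \<le> mdist U (h p) (h (shift m p))"
      "1/2 \<le> r \<or> (\<exists>g\<in>G. mdist U (h p) (h g) \<le> r)"
      using disp by blast
    have "mdist U (h p) (h (shift m p)) \<le> mdist U (h p) w + mdist U (h (shift m p)) w"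
      using mdist_triangle[OF h w(1) h] by (metis mdist_commute)
    then have "r < c" using r(1) p orbit[of m p] by simp
    then obtain g where g: "g \<in> G" "mdist U (h p) (h g) \<le> r" using r(2) c by auto
    have "mdist U (h g) w \<le> mdist U (h p) (h g) + mdist U (h p) w"
      using mdist_triangle[OF h h w(1), of g p] by (simp add: mdist_commute)
    then show ?thesis using g \<open>r < c\<close> p c by force
  qed
  then show thesis using that onto \<phi>(2) by blast
qed

theorem theorem3p10:
  fixes U :: "'u metric" and X :: "'a metric"
  assumes "Urysohn_metric U"
    and "Polish_metric X"
  shows "\<exists>X' \<phi>. isometric_copy X U X' \<and> isometry_onto U U \<phi> \<and> Fix U \<phi> = X'"
proof -
  have U: "mcomplete_of U" "separable_metric U" "mspace U \<noteq> {}"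
    and X: "mcomplete_of X" "separable_metric X"
    using assms unfolding Urysohn_metric_def Polish_metric_def by auto
  obtain u :: "nat \<Rightarrow> 'u" where u: "\<And>n. u n \<in> mspace U"
    and u_dense: "\<And>p e. p \<in> mspace U \<Longrightarrow> e > 0 \<Longrightarrow> \<exists>n. mdist U (u n) p < e"
    by (rule separable_sequence[OF U(2,3)]) (rule that)
  show ?thesis
  \<comment> \<open>An empty \<open>X\<close> has no dense sequence to start from; the discrete
    initial stage with \<open>G\<close> empty then yields an isometry without fixed points.\<close>
  proof (cases "mspace X = {}")
    case True
    obtain h where h: "\<And>p. h p \<in> mspace U" "\<And>n. u n \<in> range h"
      "\<And>p q m. mdist U (h (shift m p)) (h (shift m q)) = mdist U (h p) (h q)"
      and "\<And>p q. p \<in> carrier 0 \<Longrightarrow> q \<in> carrier 0 \<Longrightarrow> mdist U (h p) (h q) = (if p = q then 0 else 1)"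
      and disp: "\<And>p. \<exists>m r. 2 * r \<le> mdist U (h p) (h (shift m p)) \<and>
           (1/2 \<le> r \<or> (\<exists>g\<in>{}. mdist U (h p) (h g) \<le> r))"
      by (rule dense_point_map[OF assms(1) empty_subsetI stage_discrete u]) (rule that)
    have h_dense: "\<exists>p. mdist U (h p) w < e" if "w \<in> mspace U" "e > 0" for w e
    proof -
      obtain n where "mdist U (u n) w < e" using u_dense[OF \<open>w \<in> _\<close> \<open>e > 0\<close>] by blast
      moreover obtain p where "u n = h p" using h(2)[of n] by blast
      ultimately show ?thesis by metis
    qed
    obtain \<phi> where \<phi>: "isometry_onto U U \<phi>" "\<And>p. \<phi> (h p) = h (shift 1 p)"
        "\<And>w e. w \<in> Fix U \<phi> \<Longrightarrow> e > 0 \<Longrightarrow> \<exists>g\<in>{}. mdist U (h g) w < e"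
      by (rule isometry_of_point_map[OF U(1) h(1) _ h(3) disp]) (rule h_dense, assumption+, rule that)
    have "Fix U \<phi> = {}" using \<phi>(3)[OF _ zero_less_one] by blast
    moreover have "isometric_copy X U {}"
      unfolding isometric_copy_def isometry_onto_def isometric_embedding_def using True by auto
    ultimately show ?thesis using \<phi>(1) by blast
  next
    case False
    obtain x :: "nat \<Rightarrow> 'a" where x: "\<And>n. x n \<in> mspace X"
      and x_dense: "\<And>p e. p \<in> mspace X \<Longrightarrow> e > 0 \<Longrightarrow> \<exists>n. mdist X (x n) p < e"
      by (rule separable_sequence[OF X(2) False]) (rule that)
    obtain h where h: "\<And>p. h p \<in> mspace U" "\<And>n. u n \<in> range h"
      "\<And>p q m. mdist U (h (shift m p)) (h (shift m q)) = mdist U (h p) (h q)"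
      and hX: "\<And>p q. p \<in> carrier 0 \<Longrightarrow> q \<in> carrier 0 \<Longrightarrow>
        mdist U (h p) (h q) = mdist X (x (projl (fst p))) (x (projl (fst q)))"
      and disp: "\<And>p. \<exists>m r. 2 * r \<le> mdist U (h p) (h (shift m p)) \<and>
           (1/2 \<le> r \<or> (\<exists>g\<in>carrier 0. mdist U (h p) (h g) \<le> r))"
      by (rule dense_point_map[OF assms(1) order_refl stage_of_sequence[of x, OF x] u]) (rule that)
    have h_dense: "\<exists>p. mdist U (h p) w < e" if "w \<in> mspace U" "e > 0" for w e
    proof -
      obtain n where "mdist U (u n) w < e" using u_dense[OF \<open>w \<in> _\<close> \<open>e > 0\<close>] by blast
      moreover obtain p where "u n = h p" using h(2)[of n] by blast
      ultimately show ?thesis by metis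
    qed
    obtain \<phi> where \<phi>: "isometry_onto U U \<phi>" "\<And>p. \<phi> (h p) = h (shift 1 p)"
        "\<And>w e. w \<in> Fix U \<phi> \<Longrightarrow> e > 0 \<Longrightarrow> \<exists>g\<in>carrier 0. mdist U (h g) w < e"
      by (rule isometry_of_point_map[OF U(1) h(1) _ h(3) disp]) (rule h_dense, assumption+, rule that)
    have \<phi>U: "\<And>x. x \<in> mspace U \<Longrightarrow> \<phi> x \<in> mspace U"
      and \<phi>d: "\<And>x y. x \<in> mspace U \<Longrightarrow> y \<in> mspace U \<Longrightarrow> mdist U (\<phi> x) (\<phi> y) = mdist U x y"
      using \<phi>(1) unfolding isometry_onto_def isometric_embedding_def by auto
    define b where "b i = h (Inl i, 0)" for i
    have b: "b i \<in> mspace U" "mdist U (b i) (b j) = mdist X (x i) (x j)" for i j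
      using h(1) hX by (auto simp: b_def carrier_def)
    \<comment> \<open>Each orbit \<open>Inl i\<close> collapses to the single point
      \<open>b i\<close>, which is therefore fixed by \<open>\<phi>\<close>.\<close>
    have hb: "h g = b (projl (fst g))" if "g \<in> carrier 0" for g
    proof -
      have "mdist U (h g) (b (projl (fst g))) = 0"
        unfolding b_def using that x by (subst hX) (auto simp: carrier_def)
      then show ?thesis using mdist_zero[OF h(1) b(1)] by blast
    qed
    have b_fix: "\<phi> (b i) = b i" for i
      using \<phi>(2)[of "(Inl i, 0)"] hb[of "shift 1 (Inl i, 0)"] by (simp add: b_def carrier_def)
    obtain f where f: "isometric_embedding X U f" "\<And>i. f (x i) = b i"
      using isometric_extension[of U x X b] U(1) x b x_dense by metis
    have fU: "\<And>p. p \<in> mspace X \<Longrightarrow> f p \<in> mspace U"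
      and fd: "\<And>p q. p \<in> mspace X \<Longrightarrow> q \<in> mspace X \<Longrightarrow> mdist U (f p) (f q) = mdist X p q"
      using f(1) unfolding isometric_embedding_def by auto
    \<comment> \<open>The \<open>b i\<close> are fixed and approximate \<open>f p\<close>, so
      \<open>\<phi>\<close> moves \<open>f p\<close> by less than every
      \<open>e > 0\<close>.\<close>
    have "f p \<in> Fix U \<phi>" if p: "p \<in> mspace X" for p
    proof -
      have "mdist U (\<phi> (f p)) (f p) \<le> 0 + e" if "e > 0" for e
      proof -
        obtain i where i: "mdist X (x i) p < e / 2" using x_dense[OF p, of "e/2"] \<open>e > 0\<close> by auto
        have "mdist U (b i) (f p) = mdist X (x i) p" using fd[OF x p, of i] f(2) by simp
        moreover have "mdist U (b i) (\<phi> (f p)) = mdist U (b i) (f p)"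
          using \<phi>d[OF b(1) fU[OF p], of i] b_fix by simp
        moreover have "mdist U (\<phi> (f p)) (f p) \<le> mdist U (b i) (\<phi> (f p)) + mdist U (b i) (f p)"
          using mdist_triangle[OF \<phi>U[OF fU[OF p]] b(1) fU[OF p], of i] mdist_commute by metis
        ultimately show ?thesis using i by simp
      qed
      then have "mdist U (\<phi> (f p)) (f p) \<le> 0" by (rule field_le_epsilon)
      then have "mdist U (\<phi> (f p)) (f p) = 0" using mdist_nonneg[of U "\<phi> (f p)" "f p"] by linarith
      then show ?thesis using mdist_zero[OF \<phi>U[OF fU[OF p]] fU[OF p]] fU[OF p] by (simp add: Fix_def)
    qed
    \<comment> \<open>Conversely, a fixed point is a limit of points \<open>b i\<close>, and the
      image of the complete space \<open>X\<close> is closed.\<close>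
    moreover have "w \<in> f ` mspace X" if w: "w \<in> Fix U \<phi>" for w
    proof (rule isometric_embedding_range[OF X(1) f(1) x])
      show "w \<in> mspace U" using w by (simp add: Fix_def)
      fix e :: real assume "e > 0"
      then obtain g where "g \<in> carrier 0" "mdist U (h g) w < e" using \<phi>(3)[OF w] by blast
      then show "\<exists>i. mdist U (f (x i)) w < e" using hb f(2) by metis
    qed
    ultimately have "Fix U \<phi> = f ` mspace X" by blast
    moreover have "isometric_copy X U (f ` mspace X)"
      unfolding isometric_copy_def isometry_onto_def using f(1) fU
      by (auto simp: isometric_embedding_def intro!: exI[of _ f])
    ultimately show ?thesis using \<phi>(1) by blast
  qed
qed

end
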